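(* If $\alpha>0$ is an ordinal, then $\mathbb{R}_\alpha$ is disconnected in the subspace topology induced from the order topology of $\overline{\mathbb{R}}_\alpha$.
   Context: For an ordinal $\alpha$, let $\mathbb{N}_\alpha$ be the set of ordinals strictly less than $\omega^{\omega^\alpha}$ with the ordinal order and the natural (Hessenberg) sum and product. Let $\mathbb{Z}_\alpha$ be the classes of pairs $(a,b)\in\mathbb{N}_\alpha^2$ under $(a,b)\sim(c,d)\iff a+d=b+c$, with $(a,b)+(c,d)=(a+c,b+d)$, $(a,b)(c,d)=(ac+bd,ad+bc)$, order $[(a_1,a_2)]\ge[(b_1,b_2)]\iff a_1+b_2\ge a_2+b_1$. Let $\mathbb{Q}_\alpha$ be its field of fractions (classes of $(a,b)$, $b\ne0$, under $ad=bc$, usual fraction operations), a linearly ordered field with $A\ge0$ iff $ab\ge0$ for representatives and $A\ge B$ iff $A-B\ge0$; $\mathbb{Q}_\alpha^+$ denotes its positive elements. A Dedekind cut on $\mathbb{Q}_\alpha$ is a pair $(A,B)$ of subsets such that: every element of $A$ is less than every element of $B$; $\mathbb{Q}_\alpha\setminus(A\cup B)$ has at most one element; $\inf(B)\notin B$ and $\sup(A)\notin A$; $A\cap B=\varnothing$. $\overline{\mathbb{R}}_\alpha$ is the set of all such cuts, ordered by $(A_1,B_1)\ge(A_2,B_2)\iff A_2\subseteq A_1$, with the order topology whose base consists of the sets $\{z\in\overline{\mathbb{R}}_\alpha: x<z<y\}$, $x,y\in\overline{\mathbb{R}}_\alpha$. A ball in $\mathbb{Q}_\alpha$ is $\{y:|x-y|<r\}$,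 $x\in\mathbb{Q}_\alpha$, $r\in\mathbb{Q}_\alpha^+$; a cut $(A,B)$ is improper if there is $d\in\mathbb{Q}_\alpha^+$ such that every ball $U$ meeting both $A$ and $B$ has $\sup(U)-\inf(U)>d$, otherwise proper. $\mathbb{R}_\alpha\subseteq\overline{\mathbb{R}}_\alpha$ is the set of proper cuts. *)

theory Defs
  imports
    "HOL-Analysis.Abstract_Topology"
    "HOL-Library.Multiset_Order"
    "HOL-Computational_Algebra.Fraction_Field"
begin

section \<open>Ordinals below \<open>\<omega> ^ \<omega> ^ \<alpha>\<close> with Hessenberg sum and product\<close>

text \<open>
  An ordinal \<open>\<alpha> > 0\<close> is given as a type \<open>'a\<close> of class \<open>wellorder\<close>, whose elements are the
  ordinals below \<open>\<alpha>\<close>; types being nonempty, exactly \<open>\<alpha> = 0\<close> is excluded.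

  A multiset of ordinals below \<open>\<beta>\<close>, listed as \<open>\<gamma>\<^sub>1 \<ge> \<dots> \<ge> \<gamma>\<^sub>k\<close>, is the Cantor normal form of the ordinal
  \<open>\<omega> ^ \<gamma>\<^sub>1 + \<dots> + \<omega> ^ \<gamma>\<^sub>k < \<omega> ^ \<beta>\<close>. Comparing normal forms at the largest exponent whose
  multiplicities differ is the multiset order, so \<open>'a multiset\<close> is \<open>\<omega> ^ \<alpha>\<close> and
  \<open>'a multiset multiset\<close> is \<open>\<omega> ^ \<omega> ^ \<alpha>\<close>. The Hessenberg sum adds multiplicities, which is
  multiset union; the Hessenberg product is bilinear over it, with
  \<open>\<omega> ^ x \<otimes> \<omega> ^ y = \<omega> ^ (x \<oplus> y)\<close>.
\<close>

type_synonym 'a nat_ord = "'a multiset multiset"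

text \<open>The usual recursion: \<open>\<omega> ^ x\<close> is the least nonzero upper bound of all \<open>\<omega> ^ z \<cdot> n\<close>, \<open>z < x\<close>.\<close>

lemma less_omega_power_iff:
  fixes x :: "'b::wellorder"
  shows "y < {#x#} \<longleftrightarrow> y = {#} \<or> (\<exists>z<x. \<exists>n. y < replicate_mset n z)"
proof
  assume y: "y < {#x#}"
  show "y = {#} \<or> (\<exists>z<x. \<exists>n. y < replicate_mset n z)"
  proof (cases "y = {#}")
    case False
    have lt: "z < x" if "z \<in># y" for z
    proof (rule ccontr)
      assume "\<not> z < x"
      then have "{#x#} \<le> {#z#}" by auto
      also have "{#z#} \<le> y" using that by (simp add: subset_eq_imp_le_multiset)
      finally show False using y by order
    qed
    define z where "z = Max_mset y"
    have z: "z \<in># y" using False by (simp add: z_def)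
    have "y < replicate_mset (Suc (size y)) z"
      unfolding less_multiset\<^sub>H\<^sub>O
    proof (intro conjI allI impI)
      show "y \<noteq> replicate_mset (Suc (size y)) z"
        by (metis n_not_Suc_n size_replicate_mset)
      fix w assume w: "count (replicate_mset (Suc (size y)) z) w < count y w"
      then have "w \<in># y" by (metis count_inI gr_implies_not0)
      then have "w \<le> z" by (simp add: z_def)
      moreover have "w \<noteq> z"
        using w count_le_size[of y z] by auto
      ultimately show "\<exists>v>w. count y v < count (replicate_mset (Suc (size y)) z) v"
        using count_le_size[of y z] by (intro exI[of _ z]) auto
    qed
    then show ?thesis using lt[OF z] by blast
  qed simp
next
  assume "y = {#} \<or> (\<exists>z<x. \<exists>n. y < replicate_mset n z)"
  then show "y < {#x#}"
  proof (elim disjE exE conjE)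
    assume "y = {#}" then show ?thesis by simp
  next
    fix z n assume "z < x" "y < replicate_mset n z"
    moreover have "replicate_mset n z < {#x#}"
      by (rule ex_gt_imp_less_multiset) (use \<open>z < x\<close> in \<open>auto simp: in_replicate_mset\<close>)
    ultimately show ?thesis by order
  qed
qed

instantiation multiset :: (comm_monoid_add) comm_semiring_1
begin

definition one_multiset :: "'a multiset" where
  "1 = {#0#}"

definition times_multiset :: "'a multiset \<Rightarrow> 'a multiset \<Rightarrow> 'a multiset" where
  "A * B = (\<Sum>x\<in>#A. {#x + y. y \<in># B#})"

instance
proof
  fix A B C :: "'a multiset"
  have add_l: "(A + B) * C = A * C + B * C" for A B C :: "'a multiset"
    by (simp add: times_multiset_def)
  have zero_l: "{#} * C = {#}" for C :: "'a multiset"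
    by (simp add: times_multiset_def)
  have sing: "{#x#} * C = {#x + y. y \<in># C#}" for x and C :: "'a multiset"
    by (simp add: times_multiset_def)
  have add_r: "C * (A + B) = C * A + C * B" for A B C :: "'a multiset"
    by (simp add: times_multiset_def sum_mset.distrib)
  have zero_r: "C * {#} = {#}" for C :: "'a multiset"
    by (simp add: times_multiset_def)
  have sing_r: "C * {#x#} = {#y + x. y \<in># C#}" for x and C :: "'a multiset"
    by (induction C) (simp_all add: times_multiset_def)
  have am: "add_mset x A = {#x#} + A" for x and A :: "'a multiset"
    by simp
  show "A * B = B * A"
  proof (induction A)
    case empty
    show ?case by (simp only: zero_l zero_r)
  next
    case (add x A)
    have "{#x#} * B = B * {#x#}"
      by (simp only: sing sing_r add.commute)
    then show ?case by (subst (1 2) am) (simp only: add_l add_r add)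
  qed
  have s: "({#x#} * B) * C = {#x#} * (B * C)" for x and B C :: "'a multiset"
  proof (induction B)
    case empty
    show ?case by (simp only: zero_l zero_r)
  next
    case (add y B)
    have "({#x#} * {#y#}) * C = {#x#} * ({#y#} * C)"
      by (simp add: sing multiset.map_comp comp_def add.assoc)
    then show ?case by (subst (1 2) am) (simp only: add_l add_r add)
  qed
  show "(A * B) * C = A * (B * C)"
  proof (induction A)
    case empty
    show ?case by (simp only: zero_l)
  next
    case (add x A)
    show ?case by (subst (1 2) am) (simp only: add_l s add)
  qed
  show "1 * A = A"
    by (simp add: one_multiset_def sing)
  show "(A + B) * C = A * C + B * C" by (rule add_l)
  show "0 * A = 0" by (simp add: zero_l)
  show "A * 0 = 0" by (simp add: zero_r)
  show "(0::'a multiset) \<noteq> 1" by (simp add: one_multiset_def)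
qed

end

lemma omega_power_times: "{#x#} * {#y#} = {#x + y#}"
  by (simp add: times_multiset_def)

lemma hessenberg_less_cross:
  fixes a b c d :: "'b::{linorder, comm_monoid_add, ordered_cancel_ab_semigroup_add} multiset"
  assumes "a < b" "c < d"
  shows "a * d + b * c < a * c + b * d"
proof -
  obtain I J K where ab: "b = I + J" "a = I + K" "J \<noteq> {#}" "\<forall>k\<in>#K. \<exists>j\<in>#J. k < j"
    using multp_implies_one_step[of "(<)" a b] assms(1) by (auto simp: less_multiset_def)
  obtain I' J' K' where cd: "d = I' + J'" "c = I' + K'" "J' \<noteq> {#}" "\<forall>k\<in>#K'. \<exists>j\<in>#J'. k < j"
    using multp_implies_one_step[of "(<)" c d] assms(2) by (auto simp: less_multiset_def)
  define p q where "p = Max_mset J" and "q = Max_mset J'"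
  have p: "p \<in># J" "\<And>j. j \<in># J \<Longrightarrow> j \<le> p" "\<And>k. k \<in># K \<Longrightarrow> k < p"
    using ab by (auto simp: p_def intro: order_less_le_trans[OF _ Max_ge])
  have q: "q \<in># J'" "\<And>j. j \<in># J' \<Longrightarrow> j \<le> q" "\<And>k. k \<in># K' \<Longrightarrow> k < q"
    using cd by (auto simp: q_def intro: order_less_le_trans[OF _ Max_ge])
  have mem: "z \<in># A * B \<longleftrightarrow> (\<exists>x\<in>#A. \<exists>y\<in>#B. z = x + y)" for z and A B :: "'b multiset"
    by (auto simp: times_multiset_def)
  have "K * J' + J * K' < {#p + q#}"
  proof (rule ex_gt_imp_less_multiset)
    show "\<exists>y. y \<in># {#p + q#} \<and> (\<forall>x. x \<in># K * J' + J * K' \<longrightarrow> x < y)"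
      using p(2,3) q(2,3) by (auto simp: mem intro: add_less_le_mono add_le_less_mono)
  qed
  also have "{#p + q#} \<le> K * K' + J * J'"
    using p(1) q(1) by (intro subset_eq_imp_le_multiset) (auto simp: mem)
  finally have "K * J' + J * K' < K * K' + J * J'" .
  then have "(I * I' + I * J' + K * I' + I * I' + J * I' + I * K') + (K * J' + J * K')
      < (I * I' + I * J' + K * I' + I * I' + J * I' + I * K') + (K * K' + J * J')"
    by (rule add_strict_left_mono)
  then show ?thesis
    unfolding ab cd distrib_left distrib_right by (simp only: ac_simps)
qed


section \<open>The ring \<open>\<int>\<^sub>\<alpha>\<close> and the field \<open>\<rat>\<^sub>\<alpha>\<close>\<close>

definition int_ord_rel :: "'a nat_ord \<times> 'a nat_ord \<Rightarrow> 'a nat_ord \<times> 'a nat_ord \<Rightarrow> bool" where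
  "int_ord_rel = (\<lambda>(a, b) (c, d). a + d = b + c)"

quotient_type 'a int_ord = "'a nat_ord \<times> 'a nat_ord" / int_ord_rel
  morphisms Rep_int_ord Abs_int_ord
proof (rule equivpI)
  show "reflp (int_ord_rel :: 'a nat_ord \<times> _ \<Rightarrow> _)" by (auto simp: reflp_def int_ord_rel_def add.commute)
  show "symp (int_ord_rel :: 'a nat_ord \<times> _ \<Rightarrow> _)" by (auto simp: symp_def int_ord_rel_def ac_simps)
  show "transp (int_ord_rel :: 'a nat_ord \<times> _ \<Rightarrow> _)"
  proof (rule transpI, clarsimp simp: int_ord_rel_def)
    fix a b c d e f :: "'a nat_ord"
    assume "a + d = b + c" "c + f = d + e"
    then have "(a + d) + (c + f) = (b + c) + (d + e)" by simp
    then have "(a + f) + (c + d) = (b + e) + (c + d)" by (simp only: ac_simps)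
    then show "a + f = b + e" by simp
  qed
qed

instantiation int_ord :: (type) comm_ring_1
begin

lift_definition zero_int_ord :: "'a int_ord" is "(0, 0)" .

lift_definition one_int_ord :: "'a int_ord" is "(1, 0)" .

lift_definition plus_int_ord :: "'a int_ord \<Rightarrow> 'a int_ord \<Rightarrow> 'a int_ord"
  is "\<lambda>(a, b) (c, d). (a + c, b + d)"
proof (clarsimp simp: int_ord_rel_def)
  fix a b a' b' c d c' d' :: "'a nat_ord"
  assume "a + b' = b + a'" "c + d' = d + c'"
  then have "(a + b') + (c + d') = (b + a') + (d + c')" by simp
  then show "a + c + (b' + d') = b + d + (a' + c')" by (simp only: ac_simps)
qed

lift_definition uminus_int_ord :: "'a int_ord \<Rightarrow> 'a int_ord" is "\<lambda>(a, b). (b, a)"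
  by (auto simp: int_ord_rel_def)

definition minus_int_ord :: "'a int_ord \<Rightarrow> 'a int_ord \<Rightarrow> 'a int_ord" where
  "x - y = x + - y" for x y :: "'a int_ord"

lift_definition times_int_ord :: "'a int_ord \<Rightarrow> 'a int_ord \<Rightarrow> 'a int_ord"
  is "\<lambda>(a, b) (c, d). (a * c + b * d, a * d + b * c)"
proof (clarsimp simp: int_ord_rel_def)
  fix a b a' b' c d c' d' :: "'a nat_ord"
  assume 1: "a + b' = b + a'" and 2: "c + d' = d + c'"
  have "(a + b') * c + (b + a') * d + a' * (c + d') + b' * (d + c')
      = (b + a') * c + (a + b') * d + a' * (d + c') + b' * (c + d')"
    by (simp only: 1 2)
  then have "(a * c + b * d + (a' * d' + b' * c')) + (b' * c + a' * d + a' * c + b' * d)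
      = (a * d + b * c + (a' * c' + b' * d')) + (b' * c + a' * d + a' * c + b' * d)"
    by (simp only: distrib_left distrib_right ac_simps)
  then show "a * c + b * d + (a' * d' + b' * c') = a * d + b * c + (a' * c' + b' * d')"
    by (simp only: add_right_cancel)
qed

instance
proof
  fix x y z :: "'a int_ord"
  show "x * y * z = x * (y * z)"
    by transfer (auto simp: int_ord_rel_def distrib_left distrib_right ac_simps)
  show "x * y = y * x"
    by transfer (auto simp: int_ord_rel_def ac_simps)
  show "1 * x = x"
    by transfer (auto simp: int_ord_rel_def ac_simps)
  show "x + y + z = x + (y + z)"
    by transfer (auto simp: int_ord_rel_def ac_simps)
  show "x + y = y + x"
    by transfer (auto simp: int_ord_rel_def ac_simps)
  show "0 + x = x"
    by transfer (auto simp: int_ord_rel_def ac_simps)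
  show "- x + x = 0"
    by transfer (auto simp: int_ord_rel_def ac_simps)
  show "x - y = x + - y" by (rule minus_int_ord_def)
  show "(x + y) * z = x * z + y * z"
    by transfer (auto simp: int_ord_rel_def distrib_left distrib_right ac_simps)
  show "(0::'a int_ord) \<noteq> 1"
    by transfer (simp add: int_ord_rel_def one_multiset_def)
qed

end

instantiation int_ord :: (wellorder) linordered_idom
begin

lift_definition less_eq_int_ord :: "'a int_ord \<Rightarrow> 'a int_ord \<Rightarrow> bool"
  is "\<lambda>(a1, a2) (b1, b2). a1 + b2 \<le> a2 + b1"
proof (clarsimp simp: int_ord_rel_def)
  fix a b a' b' c d c' d' :: "'a nat_ord"
  assume 1: "a + b' = b + a'" and 2: "c + d' = d + c'"
  have "a + d \<le> b + c \<longleftrightarrow> (a + d) + (b' + d') \<le> (b + c) + (b' + d')"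
    by (simp only: add_le_cancel_right)
  also have "(a + d) + (b' + d') = (a + b') + (d + d')" by (simp only: ac_simps)
  also have "\<dots> = (a' + d') + (b + d)" unfolding 1 by (simp only: ac_simps)
  also have "(b + c) + (b' + d') = (c + d') + (b + b')" by (simp only: ac_simps)
  also have "\<dots> = (b' + c') + (b + d)" unfolding 2 by (simp only: ac_simps)
  finally show "(a + d \<le> b + c) = (a' + d' \<le> b' + c')"
    by (simp only: add_le_cancel_right)
qed

definition less_int_ord :: "'a int_ord \<Rightarrow> 'a int_ord \<Rightarrow> bool" where
  "x < y \<longleftrightarrow> x \<le> y \<and> \<not> y \<le> x" for x y :: "'a int_ord"

definition abs_int_ord :: "'a int_ord \<Rightarrow> 'a int_ord" where
  "\<bar>x\<bar> = (if x < 0 then - x else x)" for x :: "'a int_ord"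

definition sgn_int_ord :: "'a int_ord \<Rightarrow> 'a int_ord" where
  "sgn x = (if x = 0 then 0 else if 0 < x then 1 else - 1)" for x :: "'a int_ord"

instance
proof
  fix x y z :: "'a int_ord"
  show "x < y \<longleftrightarrow> x \<le> y \<and> \<not> y \<le> x" by (rule less_int_ord_def)
  show "\<bar>x\<bar> = (if x < 0 then - x else x)" by (rule abs_int_ord_def)
  show "sgn x = (if x = 0 then 0 else if 0 < x then 1 else - 1)" by (rule sgn_int_ord_def)
  show "x \<le> x" by transfer (auto simp: ac_simps)
  show "x \<le> y \<or> y \<le> x" by transfer (auto simp: ac_simps)
  show "x = y" if "x \<le> y" "y \<le> x"
    using that by transfer (auto simp: int_ord_rel_def ac_simps)
  show "x \<le> z" if "x \<le> y" "y \<le> z"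
    using that
  proof (transfer, clarsimp)
    fix a b c d e f :: "'a nat_ord"
    assume "a + d \<le> b + c" "c + f \<le> d + e"
    then have "(a + d) + (c + f) \<le> (b + c) + (d + e)" by (rule add_mono)
    then have "(a + f) + (c + d) \<le> (b + e) + (c + d)" by (simp only: ac_simps)
    then show "a + f \<le> b + e" by (simp only: add_le_cancel_right)
  qed
  show "z + x \<le> z + y" if "x \<le> y"
    using that by (transfer, clarsimp)
  show "z * x < z * y" if "x < y" "0 < z"
    using that unfolding less_int_ord_def
  proof (transfer, clarsimp simp: not_le)
    fix a b c d e f :: "'a nat_ord"
    assume "d + a < c + b" "f \<le> e" "e \<noteq> f"
    then have "(d + a) * e + (c + b) * f < (d + a) * f + (c + b) * e"
      using hessenberg_less_cross[of "d + a" "c + b" f e] by simp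
    then show "e * a + f * b + (e * d + f * c) \<le> e * b + f * a + (e * c + f * d) \<and>
        e * d + f * c + (e * a + f * b) < e * c + f * d + (e * b + f * a)"
      by (simp add: distrib_left distrib_right ac_simps)
  qed
qed

end

text \<open>
  The library orders fractions by \<open>a/b \<le> c/d \<longleftrightarrow> (a d) (b d) \<le> (c b) (b d)\<close>, that is, numerator times
  denominator of \<open>c/d - a/b\<close> is nonnegative.
\<close>

type_synonym 'a rat_ord = "'a int_ord fract"


section \<open>Dedekind cuts\<close>

definition is_supremum :: "'q::order set \<Rightarrow> 'q \<Rightarrow> bool" where
  "is_supremum S s \<longleftrightarrow> (\<forall>x\<in>S. x \<le> s) \<and> (\<forall>u. (\<forall>x\<in>S. x \<le> u) \<longrightarrow> s \<le> u)"

definition is_infimum :: "'q::order set \<Rightarrow> 'q \<Rightarrow> bool" where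
  "is_infimum S i \<longleftrightarrow> (\<forall>x\<in>S. i \<le> x) \<and> (\<forall>u. (\<forall>x\<in>S. u \<le> x) \<longrightarrow> u \<le> i)"

type_synonym 'q cut = "'q set \<times> 'q set"

text \<open>Suprema and infima need not exist in the field; \<open>sup A \<notin> A\<close> concerns only existing ones.\<close>

definition dedekind_cuts :: "'q::linordered_field cut set" where
  "dedekind_cuts = {(A, B).
     (\<forall>a\<in>A. \<forall>b\<in>B. a < b) \<and>
     (\<forall>x y. x \<notin> A \<union> B \<longrightarrow> y \<notin> A \<union> B \<longrightarrow> x = y) \<and>
     (\<forall>i. is_infimum B i \<longrightarrow> i \<notin> B) \<and>
     (\<forall>s. is_supremum A s \<longrightarrow> s \<notin> A) \<and>
     A \<inter> B = {}}"

text \<open>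
  The conditions on a cut also allow removing one point from \<open>A\<close> or \<open>B\<close> when \<open>A \<union> B\<close> would otherwise be
  the whole field, so inclusion of the first components is only a preorder on \<open>dedekind_cuts\<close>;
  \<open>cut_less\<close> is its strict part.
\<close>

definition cut_le :: "'q cut \<Rightarrow> 'q cut \<Rightarrow> bool" where
  "cut_le x y \<longleftrightarrow> fst x \<subseteq> fst y"

definition cut_less :: "'q cut \<Rightarrow> 'q cut \<Rightarrow> bool" where
  "cut_less x y \<longleftrightarrow> cut_le x y \<and> \<not> cut_le y x"

text \<open>
  The open intervals omit the least and the greatest cut; the whole space is therefore
  added to the generating sets.
\<close>

definition cut_topology :: "'q::linordered_field cut topology" where
  "cut_topology = topology_generated_by
     (insert dedekind_cuts
       {{z \<in> dedekind_cuts. cut_less x z \<and> cut_less z y} | x y.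
          x \<in> dedekind_cuts \<and> y \<in> dedekind_cuts})"

definition field_ball :: "'q::linordered_field \<Rightarrow> 'q \<Rightarrow> 'q set" where
  "field_ball x r = {y. \<bar>x - y\<bar> < r}"

definition improper_cut :: "'q::linordered_field cut \<Rightarrow> bool" where
  "improper_cut = (\<lambda>(A, B). \<exists>d>0. \<forall>x. \<forall>r>0.
     field_ball x r \<inter> A \<noteq> {} \<longrightarrow> field_ball x r \<inter> B \<noteq> {} \<longrightarrow>
     (\<exists>s i. is_supremum (field_ball x r) s \<and> is_infimum (field_ball x r) i \<and> s - i > d))"

definition proper_cuts :: "'q::linordered_field cut set" where
  "proper_cuts = {c \<in> dedekind_cuts. \<not> improper_cut c}"

end

theory Submission
  imports Defs
begin

text \<open>
  A proper cut whose lower class is cofinal in the natural numbers must have an infinite element in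
  its lower class, since the gap between the finite and the infinite elements is improper. So in a
  non-Archimedean field the proper cuts lying above some cut whose lower class is cofinal in the
  natural numbers, and those lying below a natural number, form a separation.
\<close>

section \<open>Principal cuts, and balls meeting both classes of a cut\<close>

definition principal_cut :: "'q::linordered_field \<Rightarrow> 'q cut" where
  "principal_cut q = ({..<q}, {q<..})"

text \<open>By density neither open ray attains an extremum. The point \<open>q\<close> stays out of
  both classes because a class containing it would attain its supremum or infimum there.\<close>

lemma principal_cut_dedekind: "principal_cut q \<in> dedekind_cuts"
proof -
  have "s \<notin> {..<q}" if "is_supremum {..<q} s" for s
    using that dense[of s q] by (force simp: is_supremum_def)
  moreover have "i \<notin> {q<..}" if "is_infimum {q<..} i" for i
    using that dense[of q i] by (force simp: is_infimum_def)
  ultimately show ?thesis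
    by (auto simp: principal_cut_def dedekind_cuts_def)
qed

lemma is_supremum_unique: "is_supremum S s \<Longrightarrow> is_supremum S t \<Longrightarrow> s = t"
  by (simp add: is_supremum_def order_antisym)

lemma is_infimum_unique: "is_infimum S s \<Longrightarrow> is_infimum S t \<Longrightarrow> s = t"
  by (simp add: is_infimum_def order_antisym)

lemma field_ball_eq: "field_ball x r = {x - r<..<x + r}"
  by (auto simp: field_ball_def abs_less_iff)

lemma is_supremum_field_ball:
  assumes "0 < r" shows "is_supremum (field_ball x r) (x + r)"
  unfolding is_supremum_def
proof (intro conjI allI impI)
  fix u assume u: "\<forall>y\<in>field_ball x r. y \<le> u"
  show "x + r \<le> u"
    by (rule dense_le_bounded[of x]) (use assms u in \<open>auto simp: field_ball_eq\<close>)
qed (auto simp: field_ball_eq)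

lemma is_infimum_field_ball:
  assumes "0 < r" shows "is_infimum (field_ball x r) (x - r)"
  unfolding is_infimum_def
proof (intro conjI allI impI)
  fix u assume u: "\<forall>y\<in>field_ball x r. u \<le> y"
  show "u \<le> x - r"
    by (rule dense_ge_bounded[of _ x]) (use assms u in \<open>auto simp: field_ball_eq\<close>)
qed (auto simp: field_ball_eq)

text \<open>By density the open interval \<open>field_ball x r\<close> has supremum
  \<open>x + r\<close> and infimum \<open>x - r\<close>, so the size in the definition is just
  \<open>2 * r\<close>.\<close>

lemma improper_cut_iff:
  "improper_cut (A, B) \<longleftrightarrow> (\<exists>d>0. \<forall>x. \<forall>r>0.
     field_ball x r \<inter> A \<noteq> {} \<longrightarrow> field_ball x r \<inter> B \<noteq> {} \<longrightarrow> d < 2 * r)"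
proof -
  have "(\<exists>s i. is_supremum (field_ball x r) s \<and> is_infimum (field_ball x r) i \<and> d < s - i)
      \<longleftrightarrow> d < 2 * r" if "0 < r" for x r d :: 'a
  proof -
    have "(x + r) - (x - r) = 2 * r" by simp
    then show ?thesis
      using is_supremum_field_ball[OF that, of x] is_infimum_field_ball[OF that, of x]
      by (metis is_supremum_unique is_infimum_unique)
  qed
  then show ?thesis
    unfolding improper_cut_def by auto
qed

lemma principal_cut_proper: "principal_cut q \<in> proper_cuts"
proof -
  have "\<exists>x r. 0 < r \<and> field_ball x r \<inter> {..<q} \<noteq> {} \<and> field_ball x r \<inter> {q<..} \<noteq> {} \<and> \<not> d < 2 * r"
    if "0 < d" for d
  proof (intro exI conjI)
    \<comment> \<open>The ball of radius \<open>d/2\<close> about \<open>q\<close> has size exactly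
      \<open>d\<close>, which fails the strict bound.\<close>
    show "field_ball q (d/2) \<inter> {..<q} \<noteq> {}"
    proof -
      obtain z where "q - d/2 < z" "z < q" using dense[of "q - d/2" q] \<open>0 < d\<close> by auto
      then have "z \<in> field_ball q (d/2) \<inter> {..<q}" using \<open>0 < d\<close> by (auto simp: field_ball_eq)
      then show ?thesis by blast
    qed
    show "field_ball q (d/2) \<inter> {q<..} \<noteq> {}"
    proof -
      obtain z where "q < z" "z < q + d/2" using dense[of q "q + d/2"] \<open>0 < d\<close> by auto
      then have "z \<in> field_ball q (d/2) \<inter> {q<..}" using \<open>0 < d\<close> by (auto simp: field_ball_eq)
      then show ?thesis by blast
    qed
  qed (use that in auto)
  then have "\<not> improper_cut (principal_cut q)"
    unfolding principal_cut_def improper_cut_iff by blast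
  then show ?thesis
    by (simp add: proper_cuts_def principal_cut_dedekind)
qed

text \<open>If a class is empty, no ball meets both, so the condition for being improper holds
  vacuously with \<open>d = 1\<close>.\<close>

lemma proper_cut_nonempty:
  assumes "(A, B) \<in> proper_cuts" shows "A \<noteq> {}" "B \<noteq> {}"
proof -
  have "\<not> improper_cut (A, B)" using assms by (simp add: proper_cuts_def)
  then show "A \<noteq> {}" "B \<noteq> {}"
    unfolding improper_cut_iff using zero_less_one by blast+
qed

lemma openin_cut_interval:
  assumes "x \<in> dedekind_cuts" "y \<in> dedekind_cuts"
  shows "openin cut_topology {z \<in> dedekind_cuts. cut_less x z \<and> cut_less z y}"
  unfolding cut_topology_def
  by (rule topology_generated_by_Basis) (use assms in blast)

text \<open>\<open>A\<close> itself need not be downward closed: a cut may omit one point lying below others of \<open>A\<close>.\<close>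

lemma proper_cut_greater_principal:
  assumes "(A, B) \<in> proper_cuts"
  shows "\<exists>q. cut_less (principal_cut q) (A, B)"
proof -
  obtain a where a: "a \<in> A" using proper_cut_nonempty[OF assms] by blast
  have cut: "\<forall>a\<in>A. \<forall>b\<in>B. a < b" "\<And>x y. x \<notin> A \<union> B \<Longrightarrow> y \<notin> A \<union> B \<Longrightarrow> x = y"
    using assms by (auto simp: proper_cuts_def dedekind_cuts_def)
  have "\<exists>q\<le>a. {..<q} \<subseteq> A"
  proof (cases "{..<a} \<subseteq> A")
    case False
    then obtain m where m: "m < a" "m \<notin> A" by blast
    \<comment> \<open>Since \<open>m < a\<close> keeps \<open>m\<close> out of \<open>B\<close>, it
      is the one omitted point. Anything below \<open>m\<close> is then in \<open>A\<close> or
      \<open>B\<close>, and being below \<open>a\<close> it cannot be in \<open>B\<close>.\<close>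
    have "y \<in> A" if "y < m" for y
      using cut a m that by (metis UnE order_less_trans order_less_asym order_less_irrefl)
    then show ?thesis using m by (intro exI[of _ m]) auto
  qed auto
  then show ?thesis
    using a by (force simp: cut_less_def cut_le_def principal_cut_def)
qed

text \<open>The shift by 1 makes the inequality strict: \<open>A\<close> may be all of
  \<open>{..<q}\<close>, but it misses \<open>q\<close> itself.\<close>

lemma cut_less_principal_cut:
  assumes "\<forall>a\<in>A. a < q"
  shows "cut_less (A, B) (principal_cut (q + 1))"
proof -
  have "A \<subseteq> {..<q + 1}" using assms by (auto intro: less_trans)
  moreover have "q \<in> {..<q + 1} - A" using assms by auto
  ultimately show ?thesis
    by (auto simp: cut_less_def cut_le_def principal_cut_def)
qed

section \<open>Cuts whose lower class is cofinal in the natural numbers\<close>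

definition unbounded_in_nat :: "'q::linordered_field cut \<Rightarrow> bool" where
  "unbounded_in_nat c \<longleftrightarrow> (\<forall>n. \<exists>a\<in>fst c. of_nat n \<le> a)"

lemma unbounded_in_nat_mono: "unbounded_in_nat x \<Longrightarrow> cut_less x z \<Longrightarrow> unbounded_in_nat z"
  unfolding unbounded_in_nat_def cut_less_def cut_le_def by blast

text \<open>If \<open>A\<close> had no infinite element, each of its elements would have another at
  least 1 above it. Every element of \<open>B\<close> would then exceed every element of
  \<open>A\<close> by more than 1, and \<open>d = 1\<close> would make the cut improper.\<close>

lemma unbounded_proper_cut_has_infinite:
  assumes "(A, B) \<in> proper_cuts" "unbounded_in_nat (A, B)"
  shows "\<exists>a\<in>A. \<forall>n. of_nat n < a"
proof (rule ccontr)
  assume "\<not> ?thesis"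
  then have fin: "\<And>a. a \<in> A \<Longrightarrow> \<exists>n. a \<le> of_nat n" by (auto simp: not_less)
  have "1 < 2 * r" if ab: "a \<in> field_ball x r" "a \<in> A" "b \<in> field_ball x r" "b \<in> B" for x r a b
  proof -
    obtain n where n: "a \<le> of_nat n" using fin ab by blast
    obtain a' where a': "a' \<in> A" "of_nat (Suc n) \<le> a'"
      using assms(2) unfolding unbounded_in_nat_def by (metis fst_conv)
    have "a' < b"
      using assms(1) a' ab by (auto simp: proper_cuts_def dedekind_cuts_def)
    then have "1 < b - a" using n a' by simp
    also have "b - a < 2 * r" using ab by (auto simp: field_ball_eq)
    finally show ?thesis .
  qed
  then have "improper_cut (A, B)"
    unfolding improper_cut_iff by (intro exI[of _ 1]) force
  then show False using assms by (simp add: proper_cuts_def)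
qed

text \<open>
  The set \<open>M\<close> has at most one element. A cut \<open>(A, B)\<close> may omit a finite point while \<open>A\<close> contains
  infinite elements; a cut below it then has to omit that point too.
\<close>

lemma finite_elements_cut_dedekind:
  fixes M :: "'q::linordered_field set"
  assumes M: "\<forall>x\<in>M. \<forall>y\<in>M. x = y"
  shows "({x. \<exists>n. x \<le> of_nat n} - M, {x. \<forall>n. of_nat n < x}) \<in> dedekind_cuts"
    (is "(?F - M, ?I) \<in> _")
  and "unbounded_in_nat ({x. \<exists>n. x \<le> of_nat n} - M, {x. \<forall>n. of_nat n < x})"
proof -
  \<comment> \<open>At most one of two consecutive numbers lies in \<open>M\<close>, so removing
    \<open>M\<close> keeps the finite elements cofinal in the natural numbers.\<close>
  have fresh: "of_nat (Suc n) \<notin> M \<or> of_nat (Suc (Suc n)) \<notin> M" for n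
    using M by (metis n_not_Suc_n of_nat_eq_iff)
  have above: "\<exists>a\<in>?F - M. of_nat n < a" for n
  proof -
    have "(of_nat n :: 'q) < of_nat (Suc n)" "(of_nat n :: 'q) < of_nat (Suc (Suc n))"
      by (simp_all only: of_nat_less_iff)
    then show ?thesis using fresh[of n] by blast
  qed
  have sup: "s \<notin> ?F - M" if "is_supremum (?F - M) s" for s
  proof
    assume "s \<in> ?F - M"
    then obtain n where "s \<le> of_nat n" by blast
    then show False
      using above[of n] that unfolding is_supremum_def by force
  qed
  have inf: "i \<notin> ?I" if "is_infimum ?I i" for i
  proof
    assume i: "i \<in> ?I"
    \<comment> \<open>Subtracting 1 from an infinite element leaves it infinite, so the infinite
      elements have no least one.\<close>
    have "of_nat n < i - 1" for n
    proof -
      have "of_nat (Suc n) < i" using i by blast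
      then show ?thesis by (simp add: algebra_simps)
    qed
    then have "i \<le> i - 1" using that unfolding is_infimum_def by blast
    then show False by simp
  qed
  have lt: "a < b" if "a \<in> ?F - M" "b \<in> ?I" for a b
    using that by (blast intro: le_less_trans)
  have "x \<in> M" if "x \<notin> (?F - M) \<union> ?I" for x
    using that by (auto simp: not_le)
  then have one: "x = y" if "x \<notin> (?F - M) \<union> ?I" "y \<notin> (?F - M) \<union> ?I" for x y
    using that M by blast
  have "(?F - M) \<inter> ?I = {}" using lt by blast
  then show "(?F - M, ?I) \<in> dedekind_cuts"
    unfolding dedekind_cuts_def using sup inf lt one by blast
  show "unbounded_in_nat (?F - M, ?I)"
    unfolding unbounded_in_nat_def fst_conv using above by (meson less_imp_le)
qed

text \<open>Supplies the left endpoint of an open interval of cofinal cuts: the gap between finite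
  and infinite elements, without the point that the cut omits. Strictness comes from an infinite
  element of \<open>A\<close>.\<close>

lemma unbounded_proper_cut_in_interval:
  fixes A B :: "'q::linordered_field set"
  assumes c: "(A, B) \<in> proper_cuts" and unb: "unbounded_in_nat (A, B)"
  shows "\<exists>x\<in>dedekind_cuts. unbounded_in_nat x \<and> cut_less x (A, B)"
proof -
  define M where "M = - (A \<union> B)"
  define x :: "'q cut" where "x = ({x. \<exists>n. x \<le> of_nat n} - M, {x. \<forall>n. of_nat n < x})"
  have cut: "\<forall>a\<in>A. \<forall>b\<in>B. a < b" "\<forall>x\<in>M. \<forall>y\<in>M. x = y"
    using c by (auto simp: proper_cuts_def dedekind_cuts_def M_def)
  have x: "x \<in> dedekind_cuts" "unbounded_in_nat x"
    unfolding x_def using finite_elements_cut_dedekind[OF cut(2)] by auto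
  have sub: "fst x \<subseteq> A"
  proof
    fix y assume y: "y \<in> fst x"
    then obtain n where n: "y \<le> of_nat n" "y \<in> A \<union> B" by (auto simp: x_def M_def)
    \<comment> \<open>Some member of \<open>A\<close> is at least \<open>y\<close>, so
      \<open>y\<close> cannot lie in \<open>B\<close>.\<close>
    obtain a where "a \<in> A" "of_nat n \<le> a"
      using unb by (auto simp: unbounded_in_nat_def)
    then show "y \<in> A" using cut(1) n by force
  qed
  obtain a where "a \<in> A" "\<forall>n. of_nat n < a"
    using unbounded_proper_cut_has_infinite[OF c unb] by blast
  then have "a \<in> A - fst x" by (auto simp: x_def not_le)
  then have "\<not> A \<subseteq> fst x" by blast
  then show ?thesis using x sub by (auto simp: cut_less_def cut_le_def)
qed

section \<open>The separation in a non-Archimedean field\<close>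

lemma proper_cuts_disconnected:
  fixes w :: "'q::linordered_field"
  assumes w: "\<And>n. of_nat n < w"
  shows "\<not> connected_space (subtopology cut_topology (proper_cuts :: 'q cut set))"
proof -
  let ?I = "\<lambda>x y :: 'q cut. {z \<in> dedekind_cuts. cut_less x z \<and> cut_less z y}"
  \<comment> \<open>Each interval in \<open>U\<close> ends at the principal cut of a natural number,
    which bounds the lower classes of its members. Each interval in \<open>V\<close> starts at a
    cofinal cut, so its members are cofinal.\<close>
  define U where "U = \<Union>{?I x (principal_cut (of_nat n)) | x n. x \<in> dedekind_cuts}"
  define V where "V = \<Union>{?I x y | x y. x \<in> dedekind_cuts \<and> y \<in> dedekind_cuts \<and> unbounded_in_nat x}"
  have oU: "openin cut_topology U" and oV: "openin cut_topology V"
    unfolding U_def V_def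
    by (rule openin_Union; use openin_cut_interval principal_cut_dedekind in blast)+
  have U: "\<not> unbounded_in_nat z" if z: "z \<in> U" for z
  proof -
    obtain n where "fst z \<subseteq> {..<of_nat n}"
      using z by (auto simp: U_def cut_less_def cut_le_def principal_cut_def)
    then show ?thesis
      unfolding unbounded_in_nat_def by (meson lessThan_iff not_le subsetD)
  qed
  have V: "unbounded_in_nat z" if z: "z \<in> V" for z
  proof -
    obtain x where "unbounded_in_nat x" "cut_less x z" using z unfolding V_def by blast
    then show ?thesis by (rule unbounded_in_nat_mono)
  qed
  have inU: "z \<in> U" if z: "z \<in> proper_cuts" "\<not> unbounded_in_nat z" for z
  proof -
    obtain A B where AB: "z = (A, B)" by (cases z)
    obtain n where "\<forall>a\<in>A. a < of_nat n"
      using z by (auto simp: AB unbounded_in_nat_def not_le)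
    from cut_less_principal_cut[OF this, of B]
    have "cut_less z (principal_cut (of_nat (Suc n)))"
      by (simp add: AB add.commute)
    moreover obtain q where "cut_less (principal_cut q) z"
      using proper_cut_greater_principal z AB by blast
    moreover have "z \<in> dedekind_cuts" using z by (simp add: proper_cuts_def)
    ultimately show ?thesis
      unfolding U_def using principal_cut_dedekind by blast
  qed
  have inV: "z \<in> V" if z: "z \<in> proper_cuts" "unbounded_in_nat z" for z
  proof -
    obtain A B where AB: "z = (A, B)" by (cases z)
    \<comment> \<open>Any \<open>b\<close> in the upper class bounds the lower one, so
      \<open>b + 1\<close> gives a right endpoint.\<close>
    obtain b where "b \<in> B" using proper_cut_nonempty z AB by blast
    then have "\<forall>a\<in>A. a < b" using z AB by (auto simp: proper_cuts_def dedekind_cuts_def)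
    then have "cut_less z (principal_cut (b + 1))"
      unfolding AB by (rule cut_less_principal_cut)
    moreover obtain x where "x \<in> dedekind_cuts" "unbounded_in_nat x" "cut_less x z"
      using unbounded_proper_cut_in_interval z AB by blast
    moreover have "z \<in> dedekind_cuts" using z by (simp add: proper_cuts_def)
    ultimately show ?thesis
      unfolding V_def using principal_cut_dedekind by blast
  qed
  have neU: "principal_cut 0 \<in> proper_cuts \<inter> U"
  proof -
    have "\<not> unbounded_in_nat (principal_cut (0::'q))"
      by (auto simp: unbounded_in_nat_def principal_cut_def not_le intro!: exI[of _ 0])
    then show ?thesis using inU principal_cut_proper by blast
  qed
  \<comment> \<open>This is where the infinite element \<open>w\<close> enters: the principal cut at
    \<open>w\<close> has every natural number in its lower class.\<close>
  have neV: "principal_cut w \<in> proper_cuts \<inter> V"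
  proof -
    have "unbounded_in_nat (principal_cut w)"
      using w by (auto simp: unbounded_in_nat_def principal_cut_def)
    then show ?thesis using inV principal_cut_proper by blast
  qed
  let ?T = "subtopology cut_topology (proper_cuts :: 'q cut set)"
  have "openin ?T (proper_cuts \<inter> U)" "openin ?T (proper_cuts \<inter> V)"
    using oU oV by (simp_all add: openin_subtopology_Int2)
  moreover have "topspace ?T \<subseteq> proper_cuts \<inter> U \<union> proper_cuts \<inter> V"
    using inU inV by auto
  moreover have "(proper_cuts \<inter> U) \<inter> (proper_cuts \<inter> V) = {}"
    using U V by blast
  moreover have "proper_cuts \<inter> U \<noteq> {}" "proper_cuts \<inter> V \<noteq> {}"
    using neU neV by auto
  ultimately show ?thesis
    unfolding connected_space_def by metis
qed

section \<open>An infinite element of the field of fractions\<close>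

lemma of_nat_less_omega: "of_nat n < ({#{#x#}#} :: 'a::wellorder nat_ord)"
proof -
  have "of_nat n = replicate_mset n ({#} :: 'a multiset)"
    by (induction n) (simp_all add: one_multiset_def)
  \<comment> \<open>The number \<open>n\<close> is \<open>n\<close> copies of the exponent 0, and
    \<open>{#x#}\<close> is a larger exponent even for the least \<open>x\<close>. The right side is
    \<open>\<omega> ^ \<omega> ^ x\<close>.\<close>
  then show ?thesis
    by (auto intro!: ex_gt_imp_less_multiset simp: in_replicate_mset)
qed

lemma rat_ord_infinite_element: "\<exists>w :: 'a::wellorder rat_ord. \<forall>n. of_nat n < w"
proof -
  \<comment> \<open>Any element of \<open>'a\<close> serves, and \<open>undefined\<close> just names
    one. That there is one, types being nonempty, is the encoding of \<alpha> > 0.\<close>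
  define v :: "'a int_ord" where "v = Abs_int_ord ({#{#undefined#}#}, 0)"
  have of_nat: "of_nat n = (Abs_int_ord (of_nat n, 0) :: 'a int_ord)" for n
    by (induction n) (simp_all add: zero_int_ord.abs_eq one_int_ord.abs_eq plus_int_ord.abs_eq)
  have "of_nat n < v" for n
    unfolding v_def of_nat less_int_ord_def less_eq_int_ord.abs_eq
    using of_nat_less_omega[of n] by (auto simp: not_le less_imp_le)
  then have "of_nat n < Fract v 1" for n
    by (simp add: of_nat_fract)
  then show ?thesis by blast
qed

theorem mainTheorem11:
  shows "\<not> connected_space
    (subtopology cut_topology (proper_cuts :: 'a::wellorder rat_ord cut set))"
proof -
  obtain w :: "'a rat_ord" where "\<And>n. of_nat n < w"
    using rat_ord_infinite_element by blast
  then show ?thesis by (rule proper_cuts_disconnected)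
qed

end
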